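(* Let $N\ge 2$ and $m\ge 1$ be integers and let $x^{(r,s)}_k$ ($1\le r,s\le N$, $1\le k\le m$) be elements of a commutative ring; set $x^{(r,s)}_{m+1}=0$ for all $1\le r,s\le N$. Let $A(N,m)$ be the $Nm\times Nm$ matrix which, as an $N\times N$ block matrix with $m\times m$ blocks, has $(r,s)$ block $A_m(x^{(r,s)}_1,\dots,x^{(r,s)}_m)$. Then $$\det(A(N,m))=\prod_{i=1}^{m}\det(X_{(i,i+1)}).$$
   Context: For elements $x_1,\dots,x_m$, $A_m(x_1,\dots,x_m)$ is the $m\times m$ matrix whose $(p,q)$ entry is $x_{m+1-\min(p,q)}$ (first row and column constantly $x_m$, bottom-right entry $x_1$). For $1\le i\le m$, $X_{(i,i+1)}$ is the $N\times N$ matrix whose $(r,s)$ entry is $x^{(r,s)}_i-x^{(r,s)}_{i+1}$. *)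

theory Defs
  imports "Jordan_Normal_Form.Determinant"
begin

text \<open>
  The library's matrices are indexed from 0, the mathematics from 1.  Row and column
  indices bound by \<open>mat\<close> below start at 0 and are shifted by 1 explicitly; the families
  \<open>x\<close>, \<open>B\<close> are indexed from 1, and \<open>x r s k\<close> stands for $x^{(r,s)}_k$.
\<close>

definition A_block :: "nat \<Rightarrow> (nat \<Rightarrow> 'a) \<Rightarrow> 'a mat" where
  "A_block m x = mat m m (\<lambda>(p, q). x (m + 1 - min (p + 1) (q + 1)))"

text \<open>Position \<open>i\<close> of \<open>N * m\<close> lies in block \<open>i div m\<close>, at offset \<open>i mod m\<close> (both from 0).\<close>

definition square_block_mat :: "nat \<Rightarrow> nat \<Rightarrow> (nat \<Rightarrow> nat \<Rightarrow> 'a mat) \<Rightarrow> 'a mat" where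
  "square_block_mat N m B =
     mat (N * m) (N * m) (\<lambda>(i, j). B (i div m + 1) (j div m + 1) $$ (i mod m, j mod m))"

definition A_mat :: "nat \<Rightarrow> nat \<Rightarrow> (nat \<Rightarrow> nat \<Rightarrow> nat \<Rightarrow> 'a) \<Rightarrow> 'a mat" where
  "A_mat N m x = square_block_mat N m (\<lambda>r s. A_block m (x r s))"

definition X_diff :: "nat \<Rightarrow> (nat \<Rightarrow> nat \<Rightarrow> nat \<Rightarrow> 'a :: comm_ring_1) \<Rightarrow> nat \<Rightarrow> 'a mat" where
  "X_diff N x i = mat N N (\<lambda>(r, s). x (r + 1) (s + 1) i - x (r + 1) (s + 1) (i + 1))"

end

(*
  Telescoping writes A_m(x_1, ..., x_m) as L diag(d_0, ..., d_(m-1)) L^T, where L is the lower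
  triangular matrix of ones and d_k = x_(m-k) - x_(m-k+1).  Since L does not depend on x, the
  factorization applies to all blocks at once: A(N, m) = (I (x) L) D (I (x) L)^T, where (x) is
  the Kronecker product and D has diagonal blocks.  The outer factors are unitriangular, and
  exchanging the roles of block number and offset in the index set makes D block diagonal with
  blocks X_(m-k,m-k+1).
*)
theory Submission
  imports Defs
begin

section \<open>Determinants of permuted and block diagonal matrices\<close>

text \<open>Permuting the rows and then the columns contributes the sign of \<open>p\<close> twice,
  and its square is 1. The columns are treated as rows of the transpose.\<close>

lemma det_conj_permutes:
  fixes f :: "nat \<Rightarrow> nat \<Rightarrow> 'a :: comm_ring_1"
  assumes p: "p permutes {0..<n}"
  shows "det (mat n n (\<lambda>(i, j). f (p i) (p j))) = det (mat n n (\<lambda>(i, j). f i j))"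
proof -
  have pn: "p i < n" if "i < n" for i
    using permutes_in_image[OF p] that by auto
  define A where "A = mat n n (\<lambda>(i, j). f i j)"
  define B where "B = mat n n (\<lambda>(i, j). f (p i) j)"
  have A: "A \<in> carrier_mat n n" and B: "B \<in> carrier_mat n n" "B\<^sup>T \<in> carrier_mat n n"
    by (auto simp: A_def B_def)
  have detB: "det B = signof p * det A"
  proof -
    have "B = mat n n (\<lambda>(i, j). A $$ (p i, j))"
      using pn by (auto simp: A_def B_def)
    then show ?thesis
      using det_permute_rows[OF A p] by simp
  qed
  have "mat n n (\<lambda>(i, j). f (p i) (p j)) = (mat n n (\<lambda>(i, j). B\<^sup>T $$ (p i, j)))\<^sup>T"
    using pn by (auto simp: B_def)
  then have "det (mat n n (\<lambda>(i, j). f (p i) (p j))) = det (mat n n (\<lambda>(i, j). B\<^sup>T $$ (p i, j)))"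
    using det_transpose[of "mat n n (\<lambda>(i, j). B\<^sup>T $$ (p i, j))" n] by simp
  also have "\<dots> = signof p * (signof p * det A)"
    using det_permute_rows[OF B(2) p] det_transpose[OF B(1)] detB by simp
  also have "\<dots> = det A"
    by (simp add: sign_def flip: mult.assoc)
  finally show ?thesis
    by (simp add: A_def)
qed

text \<open>The identity block is peeled off one row and column at a time, since a border of width
  one is handled over any commutative ring by expansion along a column.\<close>

lemma det_four_block_one_lower_right:
  fixes A :: "'a :: comm_ring_1 mat"
  assumes A: "A \<in> carrier_mat n n"
  shows "det (four_block_mat A (0\<^sub>m n k) (0\<^sub>m k n) (1\<^sub>m k)) = det A"
proof (induction k)
  case 0
  have "four_block_mat A (0\<^sub>m n 0) (0\<^sub>m 0 n) (1\<^sub>m 0) = A"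
    using A by (intro eq_matI) auto
  then show ?case by simp
next
  case (Suc k)
  let ?E = "four_block_mat A (0\<^sub>m n k) (0\<^sub>m k n) (1\<^sub>m k)"
  have "four_block_mat A (0\<^sub>m n (Suc k)) (0\<^sub>m (Suc k) n) (1\<^sub>m (Suc k)) =
      four_block_mat ?E (0\<^sub>m (n + k) 1) (0\<^sub>m 1 (n + k)) (1\<^sub>m 1)"
    using A by (intro eq_matI) auto
  moreover have "det \<dots> = det ?E * det (1\<^sub>m 1 :: 'a mat)"
    using A by (intro det_four_block_mat_upper_right_zero_col) auto
  ultimately show ?case
    using Suc by simp
qed

lemma det_four_block_one_upper_left:
  fixes A :: "'a :: comm_ring_1 mat"
  assumes A: "A \<in> carrier_mat n n"
  shows "det (four_block_mat (1\<^sub>m k) (0\<^sub>m k n) (0\<^sub>m n k) A) = det A"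
proof (induction k)
  case 0
  have "four_block_mat (1\<^sub>m 0) (0\<^sub>m 0 n) (0\<^sub>m n 0) A = A"
    using A by (intro eq_matI) auto
  then show ?case by simp
next
  case (Suc k)
  let ?E = "four_block_mat (1\<^sub>m k) (0\<^sub>m k n) (0\<^sub>m n k) A"
  have "four_block_mat (1\<^sub>m (Suc k)) (0\<^sub>m (Suc k) n) (0\<^sub>m n (Suc k)) A =
      four_block_mat (1\<^sub>m 1) (0\<^sub>m 1 (k + n)) (0\<^sub>m (k + n) 1) ?E"
    using A by (intro eq_matI) auto
  moreover have "det \<dots> = det (1\<^sub>m 1 :: 'a mat) * det ?E"
    using A by (intro det_four_block_mat_lower_left_zero_col) auto
  ultimately show ?case
    using Suc by simp
qed

text \<open>The library's determinant lemmas for triangular four-block matrices require an integral domain.\<close>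

lemma det_four_block_diagonal:
  fixes A B :: "'a :: comm_ring_1 mat"
  assumes A: "A \<in> carrier_mat n n" and B: "B \<in> carrier_mat k k"
  shows "det (four_block_mat A (0\<^sub>m n k) (0\<^sub>m k n) B) = det A * det B"
proof -
  let ?P = "four_block_mat A (0\<^sub>m n k) (0\<^sub>m k n) (1\<^sub>m k)"
  let ?Q = "four_block_mat (1\<^sub>m n) (0\<^sub>m n k) (0\<^sub>m k n) B"
  \<comment> \<open>Splitting diag(A, B) as diag(A, 1) diag(1, B) reduces the claim to
    multiplicativity of the determinant.\<close>
  have "four_block_mat A (0\<^sub>m n k) (0\<^sub>m k n) B = ?P * ?Q"
    using A B by (subst mult_four_block_mat[of _ n n _ k _ k]) auto
  also have "det \<dots> = det ?P * det ?Q"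
    using A B by (intro det_mult[of _ "n + k"]) auto
  finally show ?thesis
    using A B by (simp add: det_four_block_one_lower_right det_four_block_one_upper_left)
qed

lemma det_block_diagonal:
  fixes B :: "nat \<Rightarrow> 'a :: comm_ring_1 mat"
  assumes "\<And>k. k < m \<Longrightarrow> B k \<in> carrier_mat n n"
  shows "det (mat (m * n) (m * n)
      (\<lambda>(i, j). if i div n = j div n then B (i div n) $$ (i mod n, j mod n) else 0)) =
    (\<Prod>k<m. det (B k))"
    (is "det (?M m) = _")
  using assms
proof (induction m)
  case 0
  show ?case by simp
next
  case (Suc m)
  have "?M (Suc m) = four_block_mat (?M m) (0\<^sub>m (m * n) n) (0\<^sub>m n (m * n)) (B m)"
    (is "_ = ?F")
  proof (rule eq_matI)
    have Bm: "B m \<in> carrier_mat n n"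
      using Suc.prems by simp
    then show "dim_row (?M (Suc m)) = dim_row ?F" "dim_col (?M (Suc m)) = dim_col ?F"
      by (auto simp: add.commute)
    fix i j
    assume "i < dim_row ?F" "j < dim_col ?F"
    with Bm have ij: "i < m * n + n" "j < m * n + n"
      by auto
    \<comment> \<open>Positions from \<open>m * n\<close> on are exactly those of the last block,
      which the induction splits off.\<close>
    have hi: "k div n = m \<and> k mod n = k - m * n" if "\<not> k < m * n" "k < m * n + n" for k
    proof -
      from that have "k = m * n + (k - m * n)" "k - m * n < n" by auto
      then show ?thesis by (metis add.commute div_less div_mult_self3 mod_less mod_mult_self3
          add_0_right not_less_zero)
    qed
    have lo: "k div n < m" if "k < m * n" for k
      using that by (simp add: less_mult_imp_div_less)
    show "?M (Suc m) $$ (i, j) = ?F $$ (i, j)"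
      using ij Bm hi[of i] hi[of j] lo[of i] lo[of j]
      by (cases "i < m * n"; cases "j < m * n") (auto simp: add.commute)
  qed
  moreover have "det ?F = det (?M m) * det (B m)"
    using Suc.prems by (intro det_four_block_diagonal) auto
  ultimately show ?case
    using Suc by simp
qed

section \<open>Exchange of block number and offset\<close>

lemma transpose_index_less:
  fixes i N m :: nat
  assumes "i < N * m"
  shows "i mod m * N + i div m < N * m"
proof -
  have "0 < m"
    using assms by (auto intro: gr_zeroI)
  then have "i div m < N" "i mod m < m"
    using assms by (auto simp: less_mult_imp_div_less)
  then have "i mod m * N + i div m < Suc (i mod m) * N" "Suc (i mod m) * N \<le> m * N"
    by (simp, intro mult_le_mono1) simp
  then show ?thesis by (simp add: mult.commute)
qed

lemma transpose_index_div_mod: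
  fixes i N m :: nat
  assumes "i < N * m"
  shows "(i mod m * N + i div m) div N = i mod m" "(i mod m * N + i div m) mod N = i div m"
proof -
  have "i div m < N"
    using assms by (simp add: less_mult_imp_div_less)
  then show "(i mod m * N + i div m) div N = i mod m" "(i mod m * N + i div m) mod N = i div m"
    by auto
qed

text \<open>Block \<open>a\<close>, offset \<open>b\<close> goes to block \<open>b\<close>, offset
  \<open>a\<close>, now with blocks of size \<open>N\<close>. Division by \<open>N\<close> recovers
  both, so the map is injective, hence bijective on a finite set. Outside the range it is the
  identity, as \<open>permutes\<close> demands.\<close>

lemma transpose_index_permutes:
  fixes N m :: nat
  shows "(\<lambda>i. if i < N * m then i mod m * N + i div m else i) permutes {0..<N * m}"
proof (rule bij_imp_permutes)
  let ?p = "\<lambda>i. if i < N * m then i mod m * N + i div m else i"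
  have "inj_on ?p {0..<N * m}"
  proof (rule inj_onI)
    fix i j
    assume "i \<in> {0..<N * m}" "j \<in> {0..<N * m}" "?p i = ?p j"
    then have "i mod m = j mod m" "i div m = j div m"
      using transpose_index_div_mod[of i N m] transpose_index_div_mod[of j N m] by auto
    then show "i = j"
      by (metis div_mult_mod_eq)
  qed
  moreover have "?p ` {0..<N * m} \<subseteq> {0..<N * m}"
    using transpose_index_less by auto
  ultimately show "bij_betw ?p {0..<N * m} {0..<N * m}"
    unfolding bij_betw_def using endo_inj_surj[of "{0..<N * m}" ?p] by blast
qed auto

text \<open>An entry is nonzero only if row and column have the same offset, so sorting positions by
  offset gives a block diagonal matrix. The shifts \<open>r - 1\<close>, \<open>s - 1\<close> arise
  because blocks are numbered from 1 but \<open>d\<close> from 0.\<close>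

lemma det_square_block_mat_diagonal:
  fixes d :: "nat \<Rightarrow> nat \<Rightarrow> nat \<Rightarrow> 'a :: comm_ring_1"
  shows "det (square_block_mat N m
      (\<lambda>r s. mat m m (\<lambda>(p, q). if p = q then d p (r - 1) (s - 1) else 0))) =
    (\<Prod>k<m. det (mat N N (\<lambda>(r, s). d k r s)))"
    (is "det ?D = _")
proof -
  define f where "f = (\<lambda>i j. if i div N = j div N
    then mat N N (\<lambda>(r, s). d (i div N) r s) $$ (i mod N, j mod N) else 0)"
  define p where "p = (\<lambda>i. if i < N * m then i mod m * N + i div m else i)"
  have "?D = mat (N * m) (N * m) (\<lambda>(i, j). f (p i) (p j))"
  proof (rule eq_matI)
    fix i j
    assume "i < dim_row (mat (N * m) (N * m) (\<lambda>(i, j). f (p i) (p j)))"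
      "j < dim_col (mat (N * m) (N * m) (\<lambda>(i, j). f (p i) (p j)))"
    then have ij: "i < N * m" "j < N * m"
      by auto
    then have m: "0 < m"
      by (auto intro: gr_zeroI)
    have "i div m < N" "j div m < N"
      using ij by (auto simp: less_mult_imp_div_less)
    then show "?D $$ (i, j) = mat (N * m) (N * m) (\<lambda>(i, j). f (p i) (p j)) $$ (i, j)"
      using ij m by (simp add: square_block_mat_def f_def p_def transpose_index_div_mod)
  qed (simp_all add: square_block_mat_def)
  then have "det ?D = det (mat (N * m) (N * m) (\<lambda>(i, j). f i j))"
    unfolding p_def by (simp only: det_conj_permutes[OF transpose_index_permutes])
  also have "\<dots> = (\<Prod>k<m. det (mat N N (\<lambda>(r, s). d k r s)))"
    using det_block_diagonal[of m "\<lambda>k. mat N N (\<lambda>(r, s). d k r s)" N]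
    by (simp add: f_def mult.commute)
  finally show ?thesis .
qed

section \<open>The factorization and its determinant\<close>

text \<open>Serves both matrix products below: a factor \<open>L\<close> restricts the summation
  index to one block, leaving a sum over offsets.\<close>

lemma sum_block_index:
  fixes g :: "nat \<Rightarrow> 'a :: comm_monoid_add"
  assumes "a < N"
  shows "(\<Sum>k<N * m. if k div m = a then g (k mod m) else 0) = (\<Sum>t<m. g t)"
proof -
  have "(\<Sum>k<N * m. if k div m = a then g (k mod m) else 0) =
      (\<Sum>k\<in>{k\<in>{..<N * m}. k div m = a}. g (k mod m))"
    by (rule sum.inter_filter[symmetric]) simp
  also have "\<dots> = (\<Sum>t<m. g t)"
  proof (rule sum.reindex_bij_witness[of _ "\<lambda>t. a * m + t" "\<lambda>k. k mod m"])
    fix k assume k: "k \<in> {k \<in> {..<N * m}. k div m = a}"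
    then show "a * m + k mod m = k" by auto
    have "0 < m" using k by (auto intro: gr_zeroI)
    then show "k mod m \<in> {..<m}" by simp
  next
    fix t assume t: "t \<in> {..<m}"
    then show "(a * m + t) mod m = t" by simp
    have "a * m + t < Suc a * m" "Suc a * m \<le> N * m"
      using t assms by (simp, intro mult_le_mono1) simp
    then show "a * m + t \<in> {k \<in> {..<N * m}. k div m = a}"
      using t by simp
  qed simp
  finally show ?thesis .
qed

theorem theorem2p1:
  fixes N m :: nat
    and x :: "nat \<Rightarrow> nat \<Rightarrow> nat \<Rightarrow> 'a :: comm_ring_1"
  assumes "N \<ge> 2" and "m \<ge> 1"
    and "\<forall>r\<in>{1..N}. \<forall>s\<in>{1..N}. x r s (m + 1) = 0"
  shows "det (A_mat N m x) = (\<Prod>i = 1..m. det (X_diff N x i))"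
proof -
  define n where "n = N * m"
  define d where "d = (\<lambda>k r s. x (r + 1) (s + 1) (m - k) - x (r + 1) (s + 1) (m - k + 1))"
  define L where "L = mat n n
    (\<lambda>(i, j). if i div m = j div m \<and> j mod m \<le> i mod m then 1 else 0 :: 'a)"
  define D where "D = square_block_mat N m
    (\<lambda>r s. mat m m (\<lambda>(p, q). if p = q then d p (r - 1) (s - 1) else 0))"
  have L: "L \<in> carrier_mat n n" and D: "D \<in> carrier_mat n n"
    by (auto simp: L_def D_def n_def square_block_mat_def)
  \<comment> \<open>The term for \<open>k = 0\<close> involves \<open>x\<close> at
    \<open>m + 1\<close>; the convention that this vanishes starts the telescoping.\<close>
  have telescope: "(\<Sum>k\<le>t. d k r s) = x (r + 1) (s + 1) (m - t)"
    if "t < m" "r < N" "s < N" for t r s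
    using that
  proof (induction t)
    case 0
    then show ?case using assms(3) by (simp add: d_def)
  next
    case (Suc t)
    moreover from Suc.prems have "Suc (m - Suc t) = m - t" by simp
    ultimately show ?case by (simp add: d_def)
  qed
  \<comment> \<open>Since the blocks of \<open>D\<close> are diagonal, only the summand with offset
    \<open>j mod m\<close> survives.\<close>
  have LD: "(L * D) $$ (i, j) =
      (if j mod m \<le> i mod m then d (j mod m) (i div m) (j div m) else 0)"
    if "i < n" "j < n" for i j
  proof -
    have m: "0 < m" using assms(2) by simp
    have a: "i div m < N" using that by (simp add: n_def less_mult_imp_div_less)
    have "(L * D) $$ (i, j) = (\<Sum>k<N * m. L $$ (i, k) * D $$ (k, j))"
      using that L D by (simp add: scalar_prod_def n_def lessThan_atLeast0)
    also have "\<dots> = (\<Sum>k<N * m. if k div m = i div m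
        then if k mod m \<le> i mod m \<and> k mod m = j mod m
          then d (j mod m) (i div m) (j div m) else 0 else 0)"
      using that m by (intro sum.cong) (auto simp: L_def D_def square_block_mat_def n_def)
    also have "\<dots> = (\<Sum>t<m. if t \<le> i mod m \<and> t = j mod m
          then d (j mod m) (i div m) (j div m) else 0)"
      by (rule sum_block_index[OF a])
    also have "\<dots> = (\<Sum>t<m. if t = j mod m
          then if j mod m \<le> i mod m then d (j mod m) (i div m) (j div m) else 0 else 0)"
      by (intro sum.cong) auto
    also have "\<dots> = (if j mod m \<le> i mod m then d (j mod m) (i div m) (j div m) else 0)"
      using m by simp
    finally show ?thesis .
  qed
  have A: "A_mat N m x = L * D * L\<^sup>T"
  proof (rule eq_matI)
    fix i j
    assume "i < dim_row (L * D * L\<^sup>T)" "j < dim_col (L * D * L\<^sup>T)"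
    with L have ij: "i < n" "j < n" by auto
    have m: "0 < m" using assms(2) by simp
    have a: "i div m < N" "j div m < N"
      using ij by (auto simp: n_def less_mult_imp_div_less)
    \<comment> \<open>The left factor bounds the offset by \<open>i mod m\<close>, the transposed
      one by \<open>j mod m\<close>; together they produce the minimum in the definition of
      \<open>A_block\<close>.\<close>
    let ?t = "min (i mod m) (j mod m)"
    have t: "?t < m" using m by (simp add: min_less_iff_disj)
    have "(L * D * L\<^sup>T) $$ (i, j) = (\<Sum>k<N * m. (L * D) $$ (i, k) * L $$ (j, k))"
    proof -
      define M where "M = L * D"
      have "M \<in> carrier_mat n n" using L D by (simp add: M_def)
      with ij L have "(M * L\<^sup>T) $$ (i, j) = (\<Sum>k<N * m. M $$ (i, k) * L $$ (j, k))"
        by (simp add: scalar_prod_def n_def lessThan_atLeast0)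
      then show ?thesis by (simp only: M_def)
    qed
    also have "\<dots> = (\<Sum>k<N * m. if k div m = j div m
        then if k mod m \<le> ?t then d (k mod m) (i div m) (j div m) else 0 else 0)"
    proof (intro sum.cong refl)
      fix k assume "k \<in> {..<N * m}"
      then have k: "k < n" by (simp add: n_def)
      show "(L * D) $$ (i, k) * L $$ (j, k) = (if k div m = j div m
        then if k mod m \<le> ?t then d (k mod m) (i div m) (j div m) else 0 else 0)"
        unfolding LD[OF ij(1) k] using ij(2) k by (auto simp: L_def)
    qed
    also have "\<dots> = (\<Sum>t<m. if t \<le> ?t then d t (i div m) (j div m) else 0)"
      by (rule sum_block_index[OF a(2)])
    also have "\<dots> = (\<Sum>t\<le>?t. d t (i div m) (j div m))"
      using t by (intro sum.mono_neutral_cong_right) auto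
    also have "\<dots> = A_mat N m x $$ (i, j)"
      using ij m by (simp only: telescope[OF t a])
        (simp add: A_mat_def square_block_mat_def A_block_def n_def)
    finally show "A_mat N m x $$ (i, j) = (L * D * L\<^sup>T) $$ (i, j)" ..
  qed (simp_all add: A_mat_def square_block_mat_def L_def n_def)
  have "det L = prod_list (diag_mat L)"
  proof (rule det_lower_triangular[OF _ L])
    fix i j :: nat
    assume "i < j" "j < n"
    \<comment> \<open>Within one block, positions are ordered by their offsets.\<close>
    moreover from this have "\<not> (i div m = j div m \<and> j mod m \<le> i mod m)"
      by (metis add_le_cancel_left div_mult_mod_eq not_less)
    ultimately show "L $$ (i, j) = 0"
      by (auto simp: L_def)
  qed
  also have "\<dots> = 1"
    by (simp add: prod_list_diag_prod L_def)
  finally have "det L = 1" .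
  then have "det (A_mat N m x) = det D"
    using L D by (simp add: A det_mult[of _ n] det_transpose[OF L])
  also have "\<dots> = (\<Prod>k<m. det (X_diff N x (m - k)))"
    unfolding D_def by (simp add: det_square_block_mat_diagonal X_diff_def d_def)
  \<comment> \<open>Offset \<open>k\<close> belongs to the factor with index \<open>m - k\<close>,
    so the order of the factors is reversed.\<close>
  also have "\<dots> = (\<Prod>i = 1..m. det (X_diff N x i))"
    by (rule prod.reindex_bij_witness[of _ "\<lambda>i. m - i" "\<lambda>k. m - k"]) auto
  finally show ?thesis .
qed

end
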